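(* (Commutativity) For all $P_0, P_1 \in EC \setminus \{\infty\}$, $P_0 \oplus P_1 = P_1 \oplus P_0$.
   Context: Let $\wp = 2^{255}-19$ (a prime), $A = 486662$, and let $\mathbb{F}_\wp$ be the field of order $\wp$. Let $EC = \{(x,y) \in \mathbb{F}_\wp \times \mathbb{F}_\wp \mid y^2 = x^3 + Ax^2 + x\} \cup \{\infty\}$, where $\infty$ is a formal extra point. The operation $\oplus$ on points $P, Q \in EC$ is defined by: (1) $P \oplus \infty = \infty \oplus P = P$. (2) If $P = (x,y)$, then $P \oplus (x,-y) = \infty$. (3) If $P = (x_1,y_1)$ and $Q = (x_2,y_2) \neq (x_1,-y_1)$, let $\lambda = \frac{y_2-y_1}{x_2-x_1}$ if $x_1 \neq x_2$ and $\lambda = \frac{3x_1^2+2Ax_1+1}{2y_1}$ if $x_1 = x_2$; then $P \oplus Q = (x,y)$, where $x = \lambda^2 - A - x_1 - x_2$ and $y = \lambda(x_1 - x) - y_1$. All arithmetic is in $\mathbb{F}_\wp$. *)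

theory Defs
  imports Main "HOL-Library.Cardinality"
begin

definition wp :: nat where
  "wp = 2 ^ 255 - 19"

definition coeff_A :: "'a::field" where
  "coeff_A = 486662"

datatype 'a point = Infinity | Point 'a 'a

(* The constructions below make sense over any field; the intended one is the
   field of order wp, fixed by the constraint CARD('a) = wp where they are used. *)

definition EC :: "'a::field point set" where
  "EC = {Point x y | x y. y ^ 2 = x ^ 3 + coeff_A * x ^ 2 + x} \<union> {Infinity}"

(* On EC, x1 = x2 forces y2 = y1 or y2 = - y1, so in the tangent case y2 = y1 and
   y1 is nonzero (over characteristic other than 2): no slope divides by zero. *)

fun ec_add :: "'a::field point \<Rightarrow> 'a point \<Rightarrow> 'a point" (infixl "\<oplus>" 65) where
  "Infinity \<oplus> Q = Q"
| "Point x1 y1 \<oplus> Infinity = Point x1 y1"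
| "Point x1 y1 \<oplus> Point x2 y2 =
    (if x2 = x1 \<and> y2 = - y1 then Infinity
     else
       let l = (if x1 \<noteq> x2 then (y2 - y1) / (x2 - x1)
                else (3 * x1 ^ 2 + 2 * coeff_A * x1 + 1) / (2 * y1));
           x = l ^ 2 - coeff_A - x1 - x2;
           y = l * (x1 - x) - y1
       in Point x y)"

end

theory Submission imports Defs begin

text \<open>A sum of two points with distinct abscissas is the reflection of the third intersection
  of their chord with the curve, and the chord does not depend on their order. If the abscissas
  agree, the curve equation leaves only equal or opposite points.\<close>

lemma ec_add_commute_affine:
  fixes x1 y1 x2 y2 :: "'a::field"
  assumes P: "Point x1 y1 \<in> EC" and Q: "Point x2 y2 \<in> EC"
  shows "Point x1 y1 \<oplus> Point x2 y2 = Point x2 y2 \<oplus> Point x1 y1"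
proof (cases "x1 = x2")
  case True
  then have "y1 ^ 2 = y2 ^ 2"
    using P Q by (simp add: EC_def)
  then have "y2 = y1 \<or> y2 = - y1"
    by (auto simp: power2_eq_iff)
  \<comment> \<open>Either the points coincide, or each is the negative of the other and both sums
    are \<open>Infinity\<close>.\<close>
  then show ?thesis
    using True by auto
next
  case False
  define l where "l = (y2 - y1) / (x2 - x1)"
  have swap: "(y1 - y2) / (x1 - x2) = l"
    by (metis l_def minus_diff_eq minus_divide_divide)
  have slope: "l * (x2 - x1) = y2 - y1"
    using False by (simp add: l_def)
  define x where "x = l ^ 2 - coeff_A - x1 - x2"
  \<comment> \<open>Both sides are minus the ordinate of the chord at \<open>x\<close>, computed
    from either of its two points.\<close>
  have "l * (x1 - x) - y1 = l * (x2 - x) - y2"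
    using slope by (simp add: algebra_simps)
  moreover have "Point x1 y1 \<oplus> Point x2 y2 = Point x (l * (x1 - x) - y1)"
    using False by (simp add: Let_def l_def x_def)
  moreover have "Point x2 y2 \<oplus> Point x1 y1 = Point x (l * (x2 - x) - y2)"
    using False by (simp add: Let_def swap x_def algebra_simps)
  ultimately show ?thesis
    by simp
qed

theorem lemma7p2:
  fixes P0 P1 :: "'a::field point"
  assumes "CARD('a) = wp"
    and "P0 \<in> EC - {Infinity}"
    and "P1 \<in> EC - {Infinity}"
  shows "P0 \<oplus> P1 = P1 \<oplus> P0"
  using assms(2,3) by (cases P0; cases P1) (auto intro: ec_add_commute_affine simp del: ec_add.simps)

end
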